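(* Let $k$ be a positive integer and let $f\in\mathbb R(x_1,\dots,x_n)$ be a rational function whose indeterminacy locus $\mathrm{pol}(f)$ has codimension at least two in $\mathbb R^n$. Then $f$ extends to a function in $\mathcal R^k(\mathbb R^n)$ if and only if, for all $i_1,\dots,i_k\in\{1,\dots,n\}$, the $k$-th partial derivative $\partial^k_{x_{i_1}\cdots x_{i_k}}f$, seen as a function on $\mathrm{dom}(f)$, extends continuously to $\mathbb R^n$.
   Context: For a rational function $f$ on $\mathbb R^n$, $\mathrm{dom}(f)$ is the largest Zariski open set on which $f$ is regular (of the form $p/q$ with polynomials $p,q$, $q$ nonvanishing there) and $\mathrm{pol}(f)=\mathbb R^n\setminus\mathrm{dom}(f)$. For $k\in\mathbb N\cup\{\infty\}$, $\mathcal R^k(\mathbb R^n)$ denotes the ring of functions $f:\mathbb R^n\to\mathbb R$ of class $C^k$ that coincide with a rational function on a nonempty Zariski open subset ($k$-regulous functions). *)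

theory Defs
  imports "HOL-Analysis.Analysis"
begin

text \<open>Polynomial functions on R^n (over the infinite field R these are exactly the
  polynomials in R[x_1,...,x_n]).\<close>
inductive_set polyfun :: "(real^'n \<Rightarrow> real) set" where
  pf_const: "(\<lambda>x. c) \<in> polyfun"
| pf_var: "(\<lambda>x. x $ i) \<in> polyfun"
| pf_add: "p \<in> polyfun \<Longrightarrow> q \<in> polyfun \<Longrightarrow> (\<lambda>x. p x + q x) \<in> polyfun"
| pf_mult: "p \<in> polyfun \<Longrightarrow> q \<in> polyfun \<Longrightarrow> (\<lambda>x. p x * q x) \<in> polyfun"

text \<open>A rational function is given by a representative p/q with p, q polynomials,
  q not the zero polynomial; p/q = p'/q' iff p q' = p' q.\<close>
definition same_ratfun ::
  "(real^'n \<Rightarrow> real) \<Rightarrow> (real^'n \<Rightarrow> real) \<Rightarrow> (real^'n \<Rightarrow> real) \<Rightarrow> (real^'n \<Rightarrow> real) \<Rightarrow> bool" where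
  "same_ratfun p q p' q' \<longleftrightarrow> p' \<in> polyfun \<and> q' \<in> polyfun \<and> (\<forall>y. p y * q' y = p' y * q y)"

definition ratdom :: "(real^'n \<Rightarrow> real) \<Rightarrow> (real^'n \<Rightarrow> real) \<Rightarrow> (real^'n) set" where
  "ratdom p q = {x. \<exists>p' q'. same_ratfun p q p' q' \<and> q' x \<noteq> 0}"

definition ratpol :: "(real^'n \<Rightarrow> real) \<Rightarrow> (real^'n \<Rightarrow> real) \<Rightarrow> (real^'n) set" where
  "ratpol p q = UNIV - ratdom p q"

text \<open>The value of f at a point of dom(f) (arbitrary outside dom(f)).\<close>
definition ratval :: "(real^'n \<Rightarrow> real) \<Rightarrow> (real^'n \<Rightarrow> real) \<Rightarrow> real^'n \<Rightarrow> real" where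
  "ratval p q x = (SOME v. \<exists>p' q'. same_ratfun p q p' q' \<and> q' x \<noteq> 0 \<and> v = p' x / q' x)"

text \<open>Krull dimension of an algebraic set V: dimension of R[x]/I(V), via chains of prime
  ideals of the polynomial ring containing I(V).\<close>
definition poly_ideal :: "(real^'n \<Rightarrow> real) set \<Rightarrow> bool" where
  "poly_ideal I \<longleftrightarrow> I \<subseteq> polyfun \<and> (\<lambda>x. 0) \<in> I \<and>
     (\<forall>a\<in>I. \<forall>b\<in>I. (\<lambda>x. a x + b x) \<in> I) \<and> (\<forall>a\<in>I. \<forall>r\<in>polyfun. (\<lambda>x. r x * a x) \<in> I)"

definition poly_prime :: "(real^'n \<Rightarrow> real) set \<Rightarrow> bool" where
  "poly_prime P \<longleftrightarrow> poly_ideal P \<and> P \<noteq> polyfun \<and>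
     (\<forall>a\<in>polyfun. \<forall>b\<in>polyfun. (\<lambda>x. a x * b x) \<in> P \<longrightarrow> a \<in> P \<or> b \<in> P)"

definition vanishing_ideal :: "(real^'n) set \<Rightarrow> (real^'n \<Rightarrow> real) set" where
  "vanishing_ideal V = {p \<in> polyfun. \<forall>x\<in>V. p x = 0}"

definition alg_dim_ge :: "(real^'n) set \<Rightarrow> nat \<Rightarrow> bool" where
  "alg_dim_ge V m \<longleftrightarrow> (\<exists>P :: nat \<Rightarrow> (real^'n \<Rightarrow> real) set.
      (\<forall>j\<le>m. poly_prime (P j) \<and> vanishing_ideal V \<subseteq> P j) \<and> (\<forall>j<m. P j \<subset> P (Suc j)))"

text \<open>codimension at least two: dim V \<le> n - 2 (dim of the empty set is -1).\<close>
definition codim_ge2 :: "(real^'n) set \<Rightarrow> bool" where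
  "codim_ge2 V \<longleftrightarrow> \<not> alg_dim_ge V (CARD('n) - 1)"

definition has_partial :: "('n::finite) \<Rightarrow> (real^'n \<Rightarrow> real) \<Rightarrow> real^'n \<Rightarrow> bool" where
  "has_partial i g x \<longleftrightarrow> (\<lambda>t. g (x + t *\<^sub>R axis i 1)) differentiable (at 0)"

definition partial :: "('n::finite) \<Rightarrow> (real^'n \<Rightarrow> real) \<Rightarrow> real^'n \<Rightarrow> real" where
  "partial i g x = deriv (\<lambda>t. g (x + t *\<^sub>R axis i 1)) 0"

fun partials :: "('n::finite) list \<Rightarrow> (real^'n \<Rightarrow> real) \<Rightarrow> real^'n \<Rightarrow> real" where
  "partials [] g = g"
| "partials (i # is) g = partial i (partials is g)"

fun Ck :: "nat \<Rightarrow> (real^'n::finite \<Rightarrow> real) \<Rightarrow> bool" where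
  "Ck 0 g = continuous_on UNIV g"
| "Ck (Suc k) g = (continuous_on UNIV g \<and> (\<forall>i x. has_partial i g x) \<and> (\<forall>i. Ck k (partial i g)))"

definition regulous :: "nat \<Rightarrow> (real^'n::finite \<Rightarrow> real) \<Rightarrow> bool" where
  "regulous k g \<longleftrightarrow> Ck k g \<and> (\<exists>p q. p \<in> polyfun \<and> q \<in> polyfun \<and> (\<exists>x. q x \<noteq> 0) \<and>
     (\<exists>U. U \<noteq> {} \<and> (\<exists>h \<in> polyfun. UNIV - U = {x. h x = 0}) \<and> (\<forall>x\<in>U. q x \<noteq> 0 \<and> g x = p x / q x)))"

end

theory Submission
  imports Defs "HOL-Computational_Algebra.Polynomial"
begin

text \<open>
  Write \<open>U\<close> for the domain of \<open>f\<close>. A line through a point of \<open>U\<close> leaves \<open>U\<close> at finitely many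
  points, and on it \<open>f\<close> is a rational function of one variable. If the first partial derivatives
  of \<open>f\<close> are locally bounded, this one-variable function has bounded derivative, hence no poles,
  so the mean value inequality holds on every segment with endpoints in \<open>U\<close>, even across the
  indeterminacy locus. Applied to \<open>f\<close> minus a linear form, this shows that \<open>f\<close> extends to a
  differentiable function whose partial derivatives are the given continuous extensions. As the
  partial derivatives of \<open>f\<close> are again rational and regular on \<open>U\<close>, the case of general \<open>k\<close>
  follows by induction.
\<close>

section \<open>One variable: a mean value inequality across finitely many exceptional points\<close>

text \<open>Among all denominators of \<open>\<phi>\<close> one of least degree, \<open>Q\<close>,
  is chosen. At a zero of \<open>Q\<close> in the unit interval the derivative bound keeps
  \<open>\<phi>\<close> bounded on one side, so the numerator vanishes there too and a linear factor
  cancels, against minimality. Hence \<open>C / Q\<close> is continuous on the closed interval, and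
  integrating its derivative, known off a finite set, gives the estimate.\<close>

lemma rational_mean_value_bound:
  fixes \<phi> \<phi>' :: "real \<Rightarrow> real" and A B :: "real poly"
  assumes B: "B \<noteq> 0" and eq: "\<And>t. t \<in> T \<Longrightarrow> \<phi> t * poly B t = poly A t"
    and T: "finite (- T)" "0 \<in> T" "1 \<in> T"
    and der: "\<And>t. t \<in> T \<Longrightarrow> (\<phi> has_real_derivative \<phi>' t) (at t)"
    and I: "open I" "{0..1} \<subseteq> I"
    and bound: "\<And>t. t \<in> T \<Longrightarrow> t \<in> I \<Longrightarrow> \<bar>\<phi>' t\<bar> \<le> M"
  shows "\<bar>\<phi> 1 - \<phi> 0\<bar> \<le> M"
proof -
  \<comment> \<open>The exceptional set is any finite set and need not be \<open>- T\<close>. This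
    keeps \<open>P\<close> stable under cancelling a linear factor, at the cost of one more
    exceptional point.\<close>
  define P where "P = (\<lambda>B. B \<noteq> 0 \<and> (\<exists>A F. finite F \<and> (\<forall>t. t \<notin> F \<longrightarrow> \<phi> t * poly B t = poly A t)))"
  have "P B" unfolding P_def using B eq T(1) by (intro conjI exI[of _ A] exI[of _ "- T"]) auto
  then obtain Q where Q: "P Q" and least: "\<And>R. P R \<Longrightarrow> degree Q \<le> degree R"
    using ex_has_least_nat[of P B degree] by blast
  from Q obtain C F where Q0: "Q \<noteq> 0" and F: "finite F" and
    FQ: "\<And>t. t \<notin> F \<Longrightarrow> \<phi> t * poly Q t = poly C t" unfolding P_def by blast
  define S where "S = F \<union> - T"
  have S: "finite S" using F T by (simp add: S_def)
  have M: "0 \<le> M" using bound[of 0] T I by force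
  have nz: "poly Q t0 \<noteq> 0" if t0: "t0 \<in> {0..1}" for t0
  proof
    assume Qt0: "poly Q t0 = 0"
    have "open (I - (S - {t0}))" using S I(1) by (intro open_Diff finite_imp_closed) auto
    moreover have "t0 \<in> I - (S - {t0})" using t0 I by auto
    ultimately obtain e where e: "e > 0" "cball t0 e \<subseteq> I - (S - {t0})"
      using open_contains_cball by blast
    \<comment> \<open>The zero is approached from the right. Even for \<open>t0 = 1\<close> this
      stays inside \<open>I\<close>, because \<open>I\<close> is an open neighbourhood of the closed
      unit interval.\<close>
    define r where "r = t0 + e"
    have sub: "{t0<..r} \<subseteq> I - S"
    proof
      fix t assume "t \<in> {t0<..r}"
      then have "t \<in> cball t0 e" "t \<noteq> t0" by (auto simp: r_def dist_real_def)
      then show "t \<in> I - S" using e(2) by blast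
    qed
    \<comment> \<open>The mean value inequality between \<open>s\<close> and \<open>r\<close> bounds
      the growth of \<open>\<phi>\<close> by \<open>M\<close> times a length below \<open>e\<close>,
      uniformly as \<open>s\<close> tends to \<open>t0\<close>.\<close>
    define K where "K = \<bar>\<phi> r\<bar> + M * e"
    have Kb: "\<bar>\<phi> s\<bar> \<le> K" if s: "s \<in> {t0<..<r}" for s
    proof -
      have "norm (\<phi> r - \<phi> s) \<le> M * norm (r - s)"
      proof (rule field_differentiable_bound[of "{t0<..r}" \<phi> \<phi>' M])
        show "(\<phi> has_field_derivative \<phi>' z) (at z within {t0<..r})" if "z \<in> {t0<..r}" for z
        proof -
          have "z \<in> T" using sub that unfolding S_def by blast
          then show ?thesis using der has_field_derivative_at_within by blast
        qed
        show "norm (\<phi>' z) \<le> M" if "z \<in> {t0<..r}" for z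
        proof -
          have "z \<in> T" "z \<in> I" using sub that unfolding S_def by blast+
          then show ?thesis using bound by simp
        qed
      qed (use s in auto)
      also have "\<dots> \<le> M * e" using s M by (intro mult_left_mono) (auto simp: r_def)
      finally show ?thesis unfolding K_def by simp
    qed
    \<comment> \<open>To the right of \<open>t0\<close> the product \<open>\<phi> * Q\<close> equals
      \<open>C\<close>, so \<open>C\<close> is at most \<open>K\<close> times \<open>Q\<close> in
      absolute value and tends to 0 with \<open>Q\<close>.\<close>
    have "((\<lambda>s. poly C s) \<longlongrightarrow> 0) (at_right t0)"
    proof (rule Lim_null_comparison)
      show "\<forall>\<^sub>F s in at_right t0. norm (poly C s) \<le> K * \<bar>poly Q s\<bar>"
      proof -
        have "\<forall>\<^sub>F s in at_right t0. s \<in> {t0<..<r}"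
          using e by (intro eventually_at_right_real) (simp add: r_def)
        then show ?thesis
        proof eventually_elim
          case (elim s)
          then have "s \<in> {t0<..r}" by simp
          then have "s \<notin> F" using sub unfolding S_def by blast
          then show ?case using FQ[of s] Kb[OF elim] by (metis abs_ge_zero abs_mult mult_right_mono real_norm_def)
        qed
      qed
      have "((\<lambda>s. K * \<bar>poly Q s\<bar>) \<longlongrightarrow> K * \<bar>poly Q t0\<bar>) (at_right t0)"
        by (intro tendsto_intros)
      then show "((\<lambda>s. K * \<bar>poly Q s\<bar>) \<longlongrightarrow> 0) (at_right t0)" using Qt0 by simp
    qed
    moreover have "((\<lambda>s. poly C s) \<longlongrightarrow> poly C t0) (at_right t0)" by (intro tendsto_intros)
    ultimately have "poly C t0 = 0" using tendsto_unique[OF trivial_limit_at_right_real] by blast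
    then obtain C1 Q1 where C1: "C = [:- t0, 1:] * C1" and Q1: "Q = [:- t0, 1:] * Q1"
      using Qt0 by (metis dvdE poly_eq_0_iff_dvd)
    have "Q1 \<noteq> 0" using Q1 Q0 by auto
    moreover have "\<phi> t * poly Q1 t = poly C1 t" if "t \<notin> insert t0 F" for t
    proof -
      have "(t - t0) * (\<phi> t * poly Q1 t) = (t - t0) * poly C1 t"
        using FQ[of t] that unfolding C1 Q1 by (simp add: algebra_simps)
      then show ?thesis using that by simp
    qed
    ultimately have "P Q1" unfolding P_def using F by (metis finite_insert)
    then have "degree Q \<le> degree Q1" by (rule least)
    moreover have "degree Q = Suc (degree Q1)"
      using \<open>Q1 \<noteq> 0\<close> unfolding Q1 by (subst degree_mult_eq) auto
    ultimately show False by simp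
  qed
  define \<psi> where "\<psi> = (\<lambda>t. poly C t / poly Q t)"
  have \<psi>\<phi>: "\<psi> t = \<phi> t" if "t \<in> {0..1}" "t \<notin> S" for t
    using FQ[of t] nz that unfolding \<psi>_def S_def by (auto simp: field_simps)
  have "((\<lambda>t. \<phi>' t) has_integral \<psi> 1 - \<psi> 0) {0..1}"
  proof (rule fundamental_theorem_of_calculus_interior_strong[OF S])
    show "continuous_on {0..1} \<psi>" unfolding \<psi>_def using nz by (intro continuous_intros) auto
    fix x :: real assume x: "x \<in> {0<..<1} - S"
    have "(\<psi> has_real_derivative \<phi>' x) (at x)"
    proof (rule has_field_derivative_transform_within_open)
      show "(\<phi> has_real_derivative \<phi>' x) (at x)" using x der unfolding S_def by auto
      show "open ({0<..<1} - S)" using S by (intro open_Diff finite_imp_closed) auto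
    qed (use x \<psi>\<phi> in auto)
    then show "(\<psi> has_vector_derivative \<phi>' x) (at x)"
      by (simp add: has_real_derivative_iff_has_vector_derivative)
  qed simp
  then have "norm (\<psi> 1 - \<psi> 0) \<le> M * measure lborel {0..1::real}"
  proof (rule has_integral_bound_real[OF M S])
    show "norm (\<phi>' x) \<le> M" if "x \<in> {0..1} - S" for x using bound[of x] that I unfolding S_def by auto
  qed
  \<comment> \<open>The endpoints lie in \<open>T\<close> but possibly in \<open>F\<close>, where
    the equation for \<open>Q\<close> is not known. Both functions are continuous there and agree on
    a punctured neighbourhood, which suffices.\<close>
  moreover have end_eq: "\<psi> t = \<phi> t" if t: "t \<in> {0,1}" for t
  proof -
    have tT: "t \<in> T" using T t by auto
    have \<psi>_lim: "(\<psi> \<longlongrightarrow> \<psi> t) (at t)" unfolding \<psi>_def using nz[of t] t by (intro tendsto_intros) auto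
    have \<phi>_lim: "(\<phi> \<longlongrightarrow> \<phi> t) (at t)" using DERIV_isCont[OF der[OF tT]] by (simp add: isCont_def)
    have "\<forall>\<^sub>F s in at t. \<psi> s = \<phi> s"
    proof -
      have "open (- {s. poly Q s = 0} - (S - {t}))"
        using poly_roots_finite[OF Q0] S by (intro open_Diff finite_imp_closed open_Compl) auto
      moreover have "t \<in> - {s. poly Q s = 0} - (S - {t})" using nz[of t] t by auto
      ultimately have "\<forall>\<^sub>F s in at t. s \<in> - {s. poly Q s = 0} - (S - {t}) - {t}"
        by (rule eventually_at_in_open)
      then show ?thesis
      proof eventually_elim
        case (elim s)
        then have "s \<notin> F" "poly Q s \<noteq> 0" by (auto simp: S_def)
        then show ?case using FQ[of s] by (simp add: \<psi>_def nonzero_divide_eq_eq divide_eq_eq)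
      qed
    qed
    then have "(\<phi> \<longlongrightarrow> \<psi> t) (at t)" using \<psi>_lim by (simp add: tendsto_cong)
    then show ?thesis using \<phi>_lim by (rule tendsto_unique[OF at_neq_bot])
  qed
  ultimately show ?thesis using end_eq[of 0] end_eq[of 1] by simp
qed

section \<open>Polynomial functions: restriction to lines, derivatives, dense nonvanishing
  loci\<close>

lemma polyfun_on_line:
  assumes "p \<in> polyfun"
  obtains P where "\<And>t. p (x + t *\<^sub>R v) = poly P t"
proof -
  from assms have "\<exists>P. \<forall>t. p (x + t *\<^sub>R v) = poly P t"
  proof induction
    case (pf_const c)
    show ?case by (rule exI[of _ "[:c:]"]) simp
  next
    case (pf_var i)
    show ?case by (rule exI[of _ "[:x $ i, v $ i:]"]) simp
  next
    case (pf_add p q)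
    then show ?case by (metis poly_add)
  next
    case (pf_mult p q)
    then show ?case by (metis poly_mult)
  qed
  then show ?thesis using that by blast
qed

text \<open>That the coefficients of the derivative are again polynomial is what later makes
  regularity pass to partial derivatives.\<close>

lemma polyfun_has_derivative:
  fixes p :: "real^'n::finite \<Rightarrow> real"
  assumes "p \<in> polyfun"
  obtains p' where "\<And>i. p' i \<in> polyfun"
    "\<And>x. (p has_derivative (\<lambda>v. \<Sum>i\<in>UNIV. p' i x * v $ i)) (at x)"
proof -
  from assms have "\<exists>p'. (\<forall>i. p' i \<in> polyfun) \<and>
    (\<forall>x. (p has_derivative (\<lambda>v. \<Sum>i\<in>UNIV. p' i x * v $ i)) (at x))"
  proof induction
    case (pf_const c)
    show ?case by (rule exI[of _ "\<lambda>i x. 0"]) (auto intro: polyfun.intros)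
  next
    case (pf_var j)
    have "((\<lambda>x. x $ j) has_derivative (\<lambda>v. v $ j)) (at x)" for x :: "real^'n"
      by (rule bounded_linear_imp_has_derivative) (rule bounded_linear_vec_nth)
    moreover have "(\<Sum>i\<in>UNIV. (if i = j then 1 else 0) * v $ i) = v $ j" for v :: "real^'n"
      by (simp add: if_distrib[of "\<lambda>c. c * _"] cong: if_cong)
    ultimately show ?case
      by (intro exI[of _ "\<lambda>i x. if i = j then 1 else 0"]) (auto intro: polyfun.intros)
  next
    case (pf_add p q)
    then obtain p' q' where *: "\<And>i. p' i \<in> polyfun" "\<And>i. q' i \<in> polyfun"
      "\<And>x. (p has_derivative (\<lambda>v. \<Sum>i\<in>UNIV. p' i x * v $ i)) (at x)"
      "\<And>x. (q has_derivative (\<lambda>v. \<Sum>i\<in>UNIV. q' i x * v $ i)) (at x)" by blast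
    show ?case
      using has_derivative_add[OF *(3,4)] *(1,2)
      by (intro exI[of _ "\<lambda>i x. p' i x + q' i x"])
        (auto simp: sum.distrib distrib_right intro: polyfun.intros)
  next
    case (pf_mult p q)
    then obtain p' q' where *: "\<And>i. p' i \<in> polyfun" "\<And>i. q' i \<in> polyfun"
      "\<And>x. (p has_derivative (\<lambda>v. \<Sum>i\<in>UNIV. p' i x * v $ i)) (at x)"
      "\<And>x. (q has_derivative (\<lambda>v. \<Sum>i\<in>UNIV. q' i x * v $ i)) (at x)" by blast
    have "(\<lambda>v. p x * (\<Sum>i\<in>UNIV. q' i x * v $ i) + (\<Sum>i\<in>UNIV. p' i x * v $ i) * q x) =
        (\<lambda>v. \<Sum>i\<in>UNIV. (p x * q' i x + p' i x * q x) * v $ i)" for x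
      by (simp add: fun_eq_iff sum_distrib_left sum_distrib_right sum.distrib[symmetric] algebra_simps)
    with has_derivative_mult[OF *(3,4)]
    have "((\<lambda>x. p x * q x) has_derivative
        (\<lambda>v. \<Sum>i\<in>UNIV. (p x * q' i x + p' i x * q x) * v $ i)) (at x)" for x by simp
    moreover have "(\<lambda>x. p x * q' i x + p' i x * q x) \<in> polyfun" for i
      using *(1,2) pf_mult.hyps by (intro pf_add polyfun.pf_mult)
    ultimately show ?case by (intro exI[of _ "\<lambda>i x. p x * q' i x + p' i x * q x"]) blast
  qed
  then show ?thesis using that by blast
qed

lemma polyfun_continuous_on: "p \<in> polyfun \<Longrightarrow> continuous_on S p"
  by (induction rule: polyfun.induct) (auto intro: continuous_intros)

lemma polyfun_diff:
  assumes "p \<in> polyfun" "q \<in> polyfun"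
  shows "(\<lambda>x. p x - q x) \<in> polyfun"
  using pf_add[OF assms(1) pf_mult[OF pf_const[of "-1"] assms(2)]] by simp

text \<open>On the line from \<open>x\<close> to \<open>z\<close> the function \<open>q\<close> is a
  polynomial that is nonzero at parameter 1, so it has finitely many roots and parameter 0 is a
  limit of non-roots. For \<open>x = z\<close> the line degenerates, and openness of the
  nonvanishing locus is used instead.\<close>

lemma islimpt_polyfun_nonzero:
  fixes q :: "real^'n::finite \<Rightarrow> real"
  assumes "q \<in> polyfun" "q z \<noteq> 0"
  shows "x islimpt {y. q y \<noteq> 0}"
proof (cases "x = z")
  case True
  have "open {y. q y \<noteq> 0}"
    using polyfun_continuous_on[OF assms(1)] by (intro open_Collect_neq continuous_on_const)
  then show ?thesis using True assms by (intro interior_limit_point) (auto simp: interior_open)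
next
  case False
  obtain P where P: "\<And>t. q (x + t *\<^sub>R (z - x)) = poly P t" using polyfun_on_line[OF assms(1)] by blast
  have "poly P 1 \<noteq> 0" using P[of 1] assms by simp
  then have fin: "finite {t. poly P t = 0}" by (intro poly_roots_finite) auto
  have "(0::real) islimpt - {t. poly P t = 0}"
    using islimpt_Un_finite[OF fin, of 0 "- {t. poly P t = 0}"] islimpt_UNIV[of "0::real"] by simp
  then obtain s where s: "\<And>n::nat. s n \<in> - {t. poly P t = 0} - {0}" "s \<longlonglongrightarrow> 0"
    unfolding islimpt_sequential by blast
  have "(\<lambda>n. x + s n *\<^sub>R (z - x)) \<longlonglongrightarrow> x + 0 *\<^sub>R (z - x)" by (intro tendsto_intros s)
  moreover have "x + s n *\<^sub>R (z - x) \<in> {y. q y \<noteq> 0} - {x}" for n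
    using s(1)[of n] P[of "s n"] False by auto
  ultimately show ?thesis
    unfolding islimpt_sequential by (intro exI[of _ "\<lambda>n. x + s n *\<^sub>R (z - x)"]) simp
qed

section \<open>Iterated partial derivatives and the classes \<open>Ck\<close>\<close>

lemma has_derivative_partial:
  fixes g :: "real^'n::finite \<Rightarrow> real"
  assumes "(g has_derivative D) (at x)"
  shows "has_partial i g x" "partial i g x = D (axis i 1)"
proof -
  have "((\<lambda>t. x + t *\<^sub>R axis i 1) has_derivative (\<lambda>t. t *\<^sub>R axis i 1)) (at (0::real))"
    by (auto intro!: derivative_eq_intros)
  from has_derivative_compose[OF this, of g D] assms
  have *: "((\<lambda>t. g (x + t *\<^sub>R axis i 1)) has_derivative (\<lambda>t. D (t *\<^sub>R axis i 1))) (at 0)"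
    by simp
  then show "has_partial i g x" unfolding has_partial_def differentiable_def by blast
  have "D (t *\<^sub>R axis i 1) = t * D (axis i 1)" for t
    using has_derivative_linear[OF assms] by (simp add: linear_cmul)
  then have "((\<lambda>t. g (x + t *\<^sub>R axis i 1)) has_real_derivative D (axis i 1)) (at 0)"
    using * by (simp add: has_field_derivative_def mult.commute[of _ "D (axis i 1)"])
  then show "partial i g x = D (axis i 1)" unfolding partial_def by (rule DERIV_imp_deriv)
qed

lemma partial_cong_open:
  fixes g h :: "real^'n::finite \<Rightarrow> real"
  assumes "open U" "x \<in> U" "\<And>y. y \<in> U \<Longrightarrow> g y = h y"
  shows "partial i g x = partial i h x"
proof -
  have "((\<lambda>t. x + t *\<^sub>R axis i 1) \<longlongrightarrow> x + 0 *\<^sub>R axis i 1) (nhds (0::real))"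
    by (intro tendsto_intros) (simp add: filterlim_ident)
  then have "\<forall>\<^sub>F t in nhds (0::real). x + t *\<^sub>R axis i 1 \<in> U"
    using assms by (intro topological_tendstoD) auto
  then have "\<forall>\<^sub>F t in nhds (0::real). g (x + t *\<^sub>R axis i 1) = h (x + t *\<^sub>R axis i 1)"
    by eventually_elim (rule assms(3))
  then show ?thesis unfolding partial_def by (intro deriv_cong_ev) auto
qed

lemma partials_cong_open:
  assumes "open U" "\<And>y. y \<in> U \<Longrightarrow> g y = h y" "x \<in> U"
  shows "partials is g x = partials is h x"
  using assms(3)
proof (induction "is" arbitrary: x)
  case (Cons i "is")
  then have "partial i (partials is g) x = partial i (partials is h) x"
    by (intro partial_cong_open[OF assms(1)])
  then show ?case by simp
qed (simp add: assms)

lemma partials_append: "partials (is @ js) g = partials is (partials js g)"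
  by (induction "is") auto

lemma Ck_continuous_on: "Ck k g \<Longrightarrow> continuous_on UNIV g"
  by (cases k) auto

lemma Ck_continuous_on_partials:
  "Ck k g \<Longrightarrow> length is = k \<Longrightarrow> continuous_on UNIV (partials is g)"
proof (induction k arbitrary: g "is")
  case (Suc k)
  \<comment> \<open>\<open>partials\<close> applies the last index of the list first, and
    \<open>Ck\<close> unfolds along the first derivative taken. So the list is split at its
    end.\<close>
  then obtain js i where "is = js @ [i]" by (metis length_Suc_conv_rev)
  with Suc show ?case by (simp add: partials_append)
qed simp

section \<open>Functions regular on an open set: derivatives and the mean value inequality\<close>

text \<open>The clause on the nonvanishing locus of \<open>b\<close> guarantees that a line through a point of \<open>U\<close>
  leaves \<open>U\<close> at only finitely many points.\<close>

definition regular_on :: "(real^'n) set \<Rightarrow> (real^'n \<Rightarrow> real) \<Rightarrow> bool" where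
  "regular_on U h \<longleftrightarrow> (\<forall>x\<in>U. \<exists>a\<in>polyfun. \<exists>b\<in>polyfun. b x \<noteq> 0 \<and>
     (\<forall>y. b y \<noteq> 0 \<longrightarrow> y \<in> U) \<and> (\<forall>y\<in>U. h y * b y = a y))"

lemma regular_onE:
  assumes "regular_on U h" "x \<in> U"
  obtains a b where "a \<in> polyfun" "b \<in> polyfun" "b x \<noteq> 0" "\<And>y. b y \<noteq> 0 \<Longrightarrow> y \<in> U"
    "\<And>y. y \<in> U \<Longrightarrow> h y * b y = a y"
  using assms unfolding regular_on_def by blast

text \<open>Near \<open>x\<close> the function is a quotient \<open>a / b\<close> of polynomials
  with nonvanishing denominator, hence differentiable. By linearity the derivative is determined by
  its values on the coordinate vectors.\<close>

lemma regular_on_has_derivative: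
  fixes h :: "real^'n::finite \<Rightarrow> real"
  assumes "regular_on U h" "x \<in> U"
  shows "(h has_derivative (\<lambda>v. \<Sum>i\<in>UNIV. partial i h x * v $ i)) (at x)"
proof -
  obtain a b where ab: "a \<in> polyfun" "b \<in> polyfun" "b x \<noteq> 0" "\<And>y. b y \<noteq> 0 \<Longrightarrow> y \<in> U"
    "\<And>y. y \<in> U \<Longrightarrow> h y * b y = a y" using regular_onE[OF assms] by blast
  have "a differentiable at x" "b differentiable at x"
    using polyfun_has_derivative[OF ab(1)] polyfun_has_derivative[OF ab(2)]
    unfolding differentiable_def by metis+
  then have "(\<lambda>y. a y / b y) differentiable at x" using ab(3) by (rule differentiable_divide)
  then obtain D where "((\<lambda>y. a y / b y) has_derivative D) (at x)" unfolding differentiable_def by blast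
  moreover have "open {y. b y \<noteq> 0}"
    using polyfun_continuous_on[OF ab(2)] by (intro open_Collect_neq continuous_on_const)
  ultimately have D: "(h has_derivative D) (at x)"
    by (rule has_derivative_transform_within_open) (use ab in \<open>auto simp: field_simps\<close>)
  have lin: "linear D" using D by (rule has_derivative_linear)
  have "D v = (\<Sum>i\<in>UNIV. partial i h x * v $ i)" for v
  proof -
    have "D v = D (\<Sum>i\<in>UNIV. v $ i *\<^sub>R axis i 1)"
      by (metis basis_expansion scalar_mult_eq_scaleR)
    also have "\<dots> = (\<Sum>i\<in>UNIV. v $ i * D (axis i 1))"
      using lin by (simp add: linear_sum linear_cmul o_def)
    finally show ?thesis using has_derivative_partial(2)[OF D] by (simp add: mult.commute)
  qed
  then have "D = (\<lambda>v. \<Sum>i\<in>UNIV. partial i h x * v $ i)" by blast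
  with D show ?thesis by simp
qed

text \<open>This is the quotient rule, with new denominator \<open>b * b\<close>. Its nonvanishing
  locus is that of \<open>b\<close>, so it still lies in \<open>U\<close>.\<close>

lemma regular_on_partial:
  fixes h :: "real^'n::finite \<Rightarrow> real"
  assumes "regular_on U h" "open U"
  shows "regular_on U (partial i h)"
  unfolding regular_on_def
proof
  fix x assume x: "x \<in> U"
  obtain a b where ab: "a \<in> polyfun" "b \<in> polyfun" "b x \<noteq> 0" "\<And>y. b y \<noteq> 0 \<Longrightarrow> y \<in> U"
    "\<And>y. y \<in> U \<Longrightarrow> h y * b y = a y" using regular_onE[OF assms(1) x] by blast
  obtain a' where a': "\<And>i. a' i \<in> polyfun"
    "\<And>x. (a has_derivative (\<lambda>v. \<Sum>i\<in>UNIV. a' i x * v $ i)) (at x)"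
    using polyfun_has_derivative[OF ab(1)] by blast
  obtain b' where b': "\<And>i. b' i \<in> polyfun"
    "\<And>x. (b has_derivative (\<lambda>v. \<Sum>i\<in>UNIV. b' i x * v $ i)) (at x)"
    using polyfun_has_derivative[OF ab(2)] by blast
  have axis: "(\<Sum>j\<in>UNIV. c j * axis i 1 $ j) = c i" for c :: "'n \<Rightarrow> real"
    by (simp add: axis_def if_distrib[of "\<lambda>u. _ * u"] cong: if_cong)
  have "partial i h y * (b y * b y) = a' i y * b y - a y * b' i y" if y: "y \<in> U" for y
  proof -
    have "((\<lambda>y. h y * b y) has_derivative (\<lambda>v. h y * (\<Sum>i\<in>UNIV. b' i y * v $ i)
        + (\<Sum>i\<in>UNIV. partial i h y * v $ i) * b y)) (at y)"
      by (rule has_derivative_mult[OF regular_on_has_derivative[OF assms(1) y] b'(2)])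
    then have "partial i (\<lambda>y. h y * b y) y = h y * b' i y + partial i h y * b y"
      by (subst has_derivative_partial(2), assumption) (simp add: axis)
    moreover have "partial i a y = a' i y"
      by (subst has_derivative_partial(2)[OF a'(2)]) (rule axis)
    moreover have "partial i (\<lambda>y. h y * b y) y = partial i a y"
      using ab(5) by (intro partial_cong_open[OF assms(2) y])
    ultimately have "a' i y = h y * b' i y + partial i h y * b y" by simp
    \<comment> \<open>Multiplying the product rule by \<open>b y\<close> turns the remaining factor
      \<open>h y * b y\<close> into \<open>a y\<close>.\<close>
    then show ?thesis using ab(5)[OF y, symmetric] by (simp add: algebra_simps)
  qed
  then show "\<exists>a\<in>polyfun. \<exists>b\<in>polyfun. b x \<noteq> 0 \<and> (\<forall>y. b y \<noteq> 0 \<longrightarrow> y \<in> U) \<and>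
      (\<forall>y\<in>U. partial i h y * b y = a y)"
    using ab a' b'
    by (intro bexI[of _ "\<lambda>y. a' i y * b y - a y * b' i y"] bexI[of _ "\<lambda>y. b y * b y"])
      (auto intro!: polyfun_diff pf_mult)
qed

text \<open>The one-variable inequality is applied along the segment to \<open>h\<close> minus the
  linear form with coefficients \<open>c\<close>. The segment may leave \<open>U\<close> in between.
  The factor \<open>CARD('n)\<close> comes from bounding each coordinate of \<open>y - x\<close> by
  its norm.\<close>

lemma regular_on_mean_value_bound:
  fixes h :: "real^'n::finite \<Rightarrow> real"
  assumes h: "regular_on U h" and D: "open D" "convex D"
    and x: "x \<in> D \<inter> U" and y: "y \<in> D \<inter> U"
    and bound: "\<And>z i. z \<in> D \<inter> U \<Longrightarrow> \<bar>partial i h z - c i\<bar> \<le> e"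
  shows "\<bar>h y - h x - (\<Sum>i\<in>UNIV. c i * (y - x) $ i)\<bar> \<le> real CARD('n) * e * norm (y - x)"
proof -
  define v where "v = y - x"
  define \<gamma> where "\<gamma> = (\<lambda>t. x + t *\<^sub>R v)"
  define L where "L = (\<Sum>i\<in>UNIV. c i * v $ i)"
  define T where "T = {t. \<gamma> t \<in> U}"
  have \<gamma>: "\<gamma> 0 = x" "\<gamma> 1 = y" by (auto simp: \<gamma>_def v_def)
  obtain a b where ab: "a \<in> polyfun" "b \<in> polyfun" "b x \<noteq> 0" "\<And>y. b y \<noteq> 0 \<Longrightarrow> y \<in> U"
    "\<And>y. y \<in> U \<Longrightarrow> h y * b y = a y" using regular_onE[OF h, of x] x by blast
  obtain A where A: "\<And>t. a (\<gamma> t) = poly A t" unfolding \<gamma>_def using polyfun_on_line[OF ab(1)] by blast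
  obtain B where B: "\<And>t. b (\<gamma> t) = poly B t" unfolding \<gamma>_def using polyfun_on_line[OF ab(2)] by blast
  have B0: "B \<noteq> 0" using B[of 0] ab(3) \<gamma> by auto
  have "\<bar>(h (\<gamma> 1) - 1 * L) - (h (\<gamma> 0) - 0 * L)\<bar> \<le> real CARD('n) * e * norm v"
  proof (rule rational_mean_value_bound[where T = T and I = "\<gamma> -` D"
        and \<phi>' = "\<lambda>t. \<Sum>i\<in>UNIV. (partial i h (\<gamma> t) - c i) * v $ i"])
    show "B \<noteq> 0" by (rule B0)
    \<comment> \<open>Subtracting the linear term \<open>t * L\<close> keeps the denominator
      \<open>B\<close>; only the numerator changes.\<close>
    show "(h (\<gamma> t) - t * L) * poly B t = poly (A - [:0, L:] * B) t" if "t \<in> T" for t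
      using ab(5)[of "\<gamma> t"] that unfolding T_def A[symmetric] B[symmetric]
      by (simp add: A B algebra_simps)
    have "- T \<subseteq> {t. poly B t = 0}"
    proof
      fix t assume "t \<in> - T"
      then show "t \<in> {t. poly B t = 0}" using ab(4)[of "\<gamma> t"] B[of t] by (auto simp: T_def)
    qed
    then show "finite (- T)" using poly_roots_finite[OF B0] finite_subset by blast
    show "0 \<in> T" "1 \<in> T" using x y \<gamma> by (auto simp: T_def)
    \<comment> \<open>Convexity of \<open>D\<close> places the whole segment in \<open>D\<close>,
      and openness leaves room beyond its ends.\<close>
    show "open (\<gamma> -` D)" unfolding \<gamma>_def by (intro open_vimage D continuous_intros)
    show "{0..1} \<subseteq> \<gamma> -` D"
    proof
      fix t :: real assume "t \<in> {0..1}"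
      then have "(1 - t) *\<^sub>R x + t *\<^sub>R y \<in> D" using D(2) x y by (intro convexD) auto
      then show "t \<in> \<gamma> -` D" by (simp add: \<gamma>_def v_def algebra_simps)
    qed
    show "((\<lambda>t. h (\<gamma> t) - t * L) has_real_derivative
        (\<Sum>i\<in>UNIV. (partial i h (\<gamma> t) - c i) * v $ i)) (at t)" if "t \<in> T" for t
    proof -
      have "(\<gamma> has_derivative (\<lambda>s. s *\<^sub>R v)) (at t)"
        unfolding \<gamma>_def by (auto intro!: derivative_eq_intros)
      from has_derivative_compose[OF this regular_on_has_derivative[OF h]] that
      have "((\<lambda>t. h (\<gamma> t)) has_derivative (\<lambda>s. \<Sum>i\<in>UNIV. partial i h (\<gamma> t) * (s *\<^sub>R v) $ i)) (at t)"
        by (simp add: T_def)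
      then have "((\<lambda>t. h (\<gamma> t)) has_real_derivative (\<Sum>i\<in>UNIV. partial i h (\<gamma> t) * v $ i)) (at t)"
        unfolding has_field_derivative_def by (rule has_derivative_eq_rhs)
          (simp add: fun_eq_iff sum_distrib_left sum_distrib_right mult_ac)
      moreover have "((\<lambda>t. t * L) has_real_derivative L) (at t)"
        by (auto intro!: derivative_eq_intros)
      ultimately have "((\<lambda>t. h (\<gamma> t) - t * L) has_real_derivative
          (\<Sum>i\<in>UNIV. partial i h (\<gamma> t) * v $ i) - L) (at t)" by (rule DERIV_diff)
      then show ?thesis by (simp add: L_def left_diff_distrib sum_subtractf)
    qed
    show "\<bar>\<Sum>i\<in>UNIV. (partial i h (\<gamma> t) - c i) * v $ i\<bar> \<le> real CARD('n) * e * norm v"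
      if "t \<in> T" "t \<in> \<gamma> -` D" for t
    proof -
      have "\<bar>\<Sum>i\<in>UNIV. (partial i h (\<gamma> t) - c i) * v $ i\<bar> \<le> (\<Sum>i\<in>(UNIV::'n set). e * norm v)"
        using that bound[of "\<gamma> t"] unfolding T_def
        by (intro sum_norm_le[where f = "\<lambda>i. (partial i h (\<gamma> t) - c i) * v $ i", simplified])
          (auto simp: abs_mult intro!: mult_mono component_le_norm_cart order_trans[OF abs_ge_zero])
      then show ?thesis by simp
    qed
  qed
  then show ?thesis using \<gamma> by (simp add: v_def L_def)
qed

section \<open>Extension across the complement of a dense set of regularity\<close>

text \<open>Near every point, inside \<open>U\<close> or not, the mean value inequality makes
  \<open>h\<close> Lipschitz on \<open>U\<close>, so \<open>h\<close> has a limit along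
  \<open>U\<close>; these limits define \<open>H\<close>. The first-order estimate survives the
  passage to the limit and becomes differentiability of \<open>H\<close>.\<close>

lemma regular_on_extend:
  fixes h :: "real^'n::finite \<Rightarrow> real"
  assumes h: "regular_on U h" and dense: "\<And>x. x islimpt U"
    and g: "\<And>i. continuous_on UNIV (g i)" "\<And>i x. x \<in> U \<Longrightarrow> g i x = partial i h x"
  obtains H where "\<And>x. x \<in> U \<Longrightarrow> H x = h x"
    "\<And>x. (H has_derivative (\<lambda>v. \<Sum>i\<in>UNIV. g i x * v $ i)) (at x)"
proof -
  define N where "N = real CARD('n)"
  have N: "N > 0" unfolding N_def by simp
  have ntriv: "at x within U \<noteq> bot" for x using dense[of x] by (simp add: trivial_limit_within)
  \<comment> \<open>Continuity of each \<open>g i\<close> at \<open>x\<close> keeps the partial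
    derivatives within \<open>e / N\<close> of \<open>g i x\<close>; the division by
    \<open>N\<close> absorbs the dimension factor of the inequality.\<close>
  have local: "\<exists>d>0. \<forall>y\<in>ball x d \<inter> U. \<forall>z\<in>ball x d \<inter> U.
      \<bar>h z - h y - (\<Sum>i\<in>UNIV. g i x * (z - y) $ i)\<bar> \<le> e * norm (z - y)" if e: "e > 0" for x e
  proof -
    have "\<forall>\<^sub>F z in nhds x. \<forall>i\<in>UNIV. dist (g i z) (g i x) < e / N"
    proof (intro eventually_ball_finite ballI)
      fix i
      have "isCont (g i) x" using g(1)[of i] by (simp add: continuous_on_eq_continuous_at)
      then have "(g i \<longlongrightarrow> g i x) (nhds x)" by (simp add: isCont_def tendsto_at_iff_tendsto_nhds)
      then show "\<forall>\<^sub>F z in nhds x. dist (g i z) (g i x) < e / N" using e N by (intro tendstoD) auto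
    qed simp
    then obtain d where d: "d > 0" "\<And>z i. dist z x < d \<Longrightarrow> dist (g i z) (g i x) < e / N"
      unfolding eventually_nhds_metric by blast
    have "\<bar>h z - h y - (\<Sum>i\<in>UNIV. g i x * (z - y) $ i)\<bar> \<le> N * (e / N) * norm (z - y)"
      if "y \<in> ball x d \<inter> U" "z \<in> ball x d \<inter> U" for y z
      unfolding N_def
    proof (rule regular_on_mean_value_bound[OF h open_ball convex_ball that])
      fix w i assume "w \<in> ball x d \<inter> U"
      then show "\<bar>partial i h w - g i x\<bar> \<le> e / real CARD('n)"
        using d(2)[of w i] g(2)[of w i] by (simp add: dist_commute dist_real_def N_def)
    qed
    then show ?thesis using d(1) N by auto
  qed
  have "\<exists>l. (h \<longlongrightarrow> l) (at x within U)" for x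
  proof -
    obtain d where d: "d > 0" "\<And>y z. y \<in> ball x d \<inter> U \<Longrightarrow> z \<in> ball x d \<inter> U \<Longrightarrow>
      \<bar>h z - h y - (\<Sum>i\<in>UNIV. g i x * (z - y) $ i)\<bar> \<le> 1 * norm (z - y)"
      using local[of 1 x] by auto
    \<comment> \<open>The 1 comes from the estimate with error constant 1, the sum from the linear
      form with coefficients \<open>g i x\<close>.\<close>
    define K where "K = 1 + (\<Sum>i\<in>UNIV. \<bar>g i x\<bar>)"
    have "K-lipschitz_on (ball x d \<inter> U) h"
    proof (rule lipschitz_onI)
      fix z y assume zy: "z \<in> ball x d \<inter> U" "y \<in> ball x d \<inter> U"
      have "\<bar>\<Sum>i\<in>UNIV. g i x * (z - y) $ i\<bar> \<le> (\<Sum>i\<in>UNIV. \<bar>g i x\<bar> * norm (z - y))"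
        by (rule order_trans[OF sum_abs], rule sum_mono)
          (simp only: abs_mult, intro mult_left_mono component_le_norm_cart, simp)
      then show "dist (h z) (h y) \<le> K * dist z y"
        using d(2)[OF zy(2,1)] unfolding K_def dist_norm by (simp add: algebra_simps sum_distrib_left sum_distrib_right)
    qed (simp add: K_def sum_nonneg add_nonneg_nonneg)
    then have "uniformly_continuous_on (ball x d \<inter> U) h" by (rule lipschitz_on_uniformly_continuous)
    moreover have "x \<in> closure (ball x d \<inter> U)"
    proof -
      have "x \<in> ball x d \<inter> closure U" using dense[of x] d(1) by (simp add: closure_def)
      then show ?thesis using open_Int_closure_subset[OF open_ball] by blast
    qed
    ultimately obtain l where "(h \<longlongrightarrow> l) (at x within (ball x d \<inter> U))"
      using uniformly_continuous_on_extension_at_closure by blast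
    moreover have "at x within (ball x d \<inter> U) = at x within U"
      using d(1) by (intro at_within_nhd[of x "ball x d"]) auto
    ultimately show ?thesis by auto
  qed
  then obtain H where H: "\<And>x. (h \<longlongrightarrow> H x) (at x within U)" by metis
  show ?thesis
  proof
    fix x assume x: "x \<in> U"
    have "(h \<longlongrightarrow> h x) (at x within U)"
      using has_derivative_continuous[OF regular_on_has_derivative[OF h x]]
      unfolding continuous_at by (rule tendsto_within_subset) simp
    then show "H x = h x" using tendsto_unique[OF ntriv H] by blast
  next
    fix x
    have near: "\<forall>\<^sub>F z in at y within U. z \<in> ball x d \<inter> U" if "y \<in> ball x d" for y d
      using that by (metis (mono_tags, lifting) IntI eventually_at_topological open_ball)
    have "\<exists>d>0. \<forall>y. norm (y - x) < d \<longrightarrow>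
      norm (H y - H x - (\<Sum>i\<in>UNIV. g i x * (y - x) $ i)) \<le> e * norm (y - x)" if "e > 0" for e
    proof -
      obtain d where d: "d > 0" "\<And>y z. y \<in> ball x d \<inter> U \<Longrightarrow> z \<in> ball x d \<inter> U \<Longrightarrow>
        \<bar>h z - h y - (\<Sum>i\<in>UNIV. g i x * (z - y) $ i)\<bar> \<le> e * norm (z - y)"
        using local[OF \<open>e > 0\<close>, of x] by auto
      \<comment> \<open>First limit: \<open>y\<close> tends to \<open>x\<close> inside
        \<open>U\<close>, with \<open>z\<close> in \<open>U\<close> fixed.\<close>
      have 1: "\<bar>h z - H x - (\<Sum>i\<in>UNIV. g i x * (z - x) $ i)\<bar> \<le> e * norm (z - x)"
        if z: "z \<in> ball x d \<inter> U" for z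
      proof (rule tendsto_le[OF ntriv])
        show "((\<lambda>y. e * norm (z - y)) \<longlongrightarrow> e * norm (z - x)) (at x within U)"
          by (intro tendsto_intros)
        show "((\<lambda>y. \<bar>h z - h y - (\<Sum>i\<in>UNIV. g i x * (z - y) $ i)\<bar>) \<longlongrightarrow>
          \<bar>h z - H x - (\<Sum>i\<in>UNIV. g i x * (z - x) $ i)\<bar>) (at x within U)"
          by (intro tendsto_intros H)
        show "\<forall>\<^sub>F y in at x within U. \<bar>h z - h y - (\<Sum>i\<in>UNIV. g i x * (z - y) $ i)\<bar> \<le> e * norm (z - y)"
          using near[of x d] d z by (auto elim!: eventually_mono)
      qed
      \<comment> \<open>Second limit: \<open>z\<close> tends inside \<open>U\<close> to an arbitrary
        point \<open>y\<close> of the ball.\<close>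
      have "\<bar>H y - H x - (\<Sum>i\<in>UNIV. g i x * (y - x) $ i)\<bar> \<le> e * norm (y - x)"
        if y: "y \<in> ball x d" for y
      proof (rule tendsto_le[OF ntriv])
        show "((\<lambda>z. e * norm (z - x)) \<longlongrightarrow> e * norm (y - x)) (at y within U)"
          by (intro tendsto_intros)
        show "((\<lambda>z. \<bar>h z - H x - (\<Sum>i\<in>UNIV. g i x * (z - x) $ i)\<bar>) \<longlongrightarrow>
          \<bar>H y - H x - (\<Sum>i\<in>UNIV. g i x * (y - x) $ i)\<bar>) (at y within U)"
          by (intro tendsto_intros H)
        show "\<forall>\<^sub>F z in at y within U. \<bar>h z - H x - (\<Sum>i\<in>UNIV. g i x * (z - x) $ i)\<bar> \<le> e * norm (z - x)"
          using near[OF y] 1 by (auto elim!: eventually_mono)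
      qed
      then show ?thesis using d(1) by (auto simp: dist_norm norm_minus_commute)
    qed
    moreover have "bounded_linear (\<lambda>v::real^'n. \<Sum>i\<in>UNIV. g i x * v $ i)"
      by (intro bounded_linear_intros bounded_linear_vec_nth)
    ultimately show "(H has_derivative (\<lambda>v. \<Sum>i\<in>UNIV. g i x * v $ i)) (at x)"
      unfolding has_derivative_at_alt by blast
  qed
qed

text \<open>Induction on \<open>k\<close> for all \<open>h\<close> at once: the first partial
  derivatives are regular on \<open>U\<close> and satisfy the hypothesis one order lower. Their
  \<open>Ck\<close> extensions are continuous, so \<open>h\<close> extends differentiably with
  exactly these as partial derivatives.\<close>

lemma regular_on_Ck_extend:
  fixes h :: "real^'n::finite \<Rightarrow> real"
  assumes "open U" "\<And>x. x islimpt U" "regular_on U h"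
    and "\<And>is. length is = k \<Longrightarrow> \<exists>g. continuous_on UNIV g \<and> (\<forall>x\<in>U. g x = partials is h x)"
  shows "\<exists>H. Ck k H \<and> (\<forall>x\<in>U. H x = h x)"
  using assms(3,4)
proof (induction k arbitrary: h)
  case 0
  show ?case using 0(2)[of "[]"] by simp
next
  case (Suc k)
  have "\<exists>G. Ck k G \<and> (\<forall>x\<in>U. G x = partial i h x)" for i
  proof (rule Suc.IH)
    show "regular_on U (partial i h)" using Suc.prems(1) assms(1) by (rule regular_on_partial)
    show "\<exists>g. continuous_on UNIV g \<and> (\<forall>x\<in>U. g x = partials is (partial i h) x)"
      if "length is = k" for "is"
      using Suc.prems(2)[of "is @ [i]"] that by (simp add: partials_append)
  qed
  then obtain G where G: "\<And>i. Ck k (G i)" "\<And>i x. x \<in> U \<Longrightarrow> G i x = partial i h x" by metis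
  obtain H where H: "\<And>x. x \<in> U \<Longrightarrow> H x = h x"
    "\<And>x. (H has_derivative (\<lambda>v. \<Sum>i\<in>UNIV. G i x * v $ i)) (at x)"
    using regular_on_extend[OF Suc.prems(1) assms(2) Ck_continuous_on[OF G(1)] G(2)] by blast
  \<comment> \<open>The equality holds on the whole space, not only on \<open>U\<close>, so the
    class of \<open>G i\<close> raises that of \<open>H\<close> by one.\<close>
  have "partial i H = G i" for i
    using has_derivative_partial(2)[OF H(2)]
    by (simp add: fun_eq_iff axis_def if_distrib[of "\<lambda>u. _ * u"] cong: if_cong)
  moreover have "continuous_on UNIV H"
    using has_derivative_continuous[OF H(2)] by (simp add: continuous_on_eq_continuous_at)
  ultimately have "Ck (Suc k) H"
    using G(1) has_derivative_partial(1)[OF H(2)] by auto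
  then show ?case using H(1) by blast
qed

section \<open>Rational functions as regular functions on their domain\<close>

text \<open>The chosen value does not depend on the representative: the cross difference
  \<open>w\<close> of two representatives vanishes where \<open>q\<close> does not, hence everywhere
  by density and continuity. The product form also covers points of the domain where
  \<open>q'\<close> vanishes, as \<open>regular_on\<close> requires.\<close>

lemma same_ratfun_ratval:
  fixes p q :: "real^'n::finite \<Rightarrow> real"
  assumes q: "q \<in> polyfun" "q z \<noteq> 0" and p': "same_ratfun p q p' q'" and x: "x \<in> ratdom p q"
  shows "ratval p q x * q' x = p' x"
proof -
  have "\<exists>v p' q'. same_ratfun p q p' q' \<and> q' x \<noteq> 0 \<and> v = p' x / q' x"
    using x unfolding ratdom_def by blast
  from someI_ex[OF this] obtain p'' q'' where
    p'': "same_ratfun p q p'' q''" "q'' x \<noteq> 0" "ratval p q x = p'' x / q'' x"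
    unfolding ratval_def by blast
  define w where "w = (\<lambda>y. p' y * q'' y - p'' y * q' y)"
  have poly: "p' \<in> polyfun" "q' \<in> polyfun" "p'' \<in> polyfun" "q'' \<in> polyfun"
    using p' p''(1) unfolding same_ratfun_def by auto
  have wp: "w \<in> polyfun" unfolding w_def using poly by (intro polyfun_diff pf_mult)
  have w0: "w y = 0" if "q y \<noteq> 0" for y
  proof -
    have "p y * q' y = p' y * q y" "p y * q'' y = p'' y * q y"
      using p' p''(1) unfolding same_ratfun_def by auto
    then have "q y * w y = 0" unfolding w_def by algebra
    then show ?thesis using that by simp
  qed
  have "w x = 0"
  proof (rule ccontr)
    assume "w x \<noteq> 0"
    moreover have "open {y. w y \<noteq> 0}"
      using polyfun_continuous_on[OF wp] by (intro open_Collect_neq continuous_on_const)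
    ultimately obtain y where "y \<in> {y. q y \<noteq> 0}" "y \<in> {y. w y \<noteq> 0}"
      using islimptE[OF islimpt_polyfun_nonzero[OF q, of x], of "{y. w y \<noteq> 0}"] by blast
    then show False using w0 by simp
  qed
  then have "p' x * q'' x = p'' x * q' x" unfolding w_def by simp
  then show ?thesis using p''(2) unfolding p''(3) by (simp add: nonzero_divide_eq_eq divide_eq_eq)
qed

lemma ratdom_eq_Union:
  "ratdom p q = (\<Union>q' \<in> {q'. \<exists>p'. same_ratfun p q p' q'}. {x. q' x \<noteq> 0})"
  unfolding ratdom_def by auto

lemma open_ratdom: "open (ratdom p q)"
  unfolding ratdom_eq_Union same_ratfun_def
  by (intro open_UN ballI open_Collect_neq continuous_on_const polyfun_continuous_on) auto

lemma regular_on_ratval: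
  fixes p q :: "real^'n::finite \<Rightarrow> real"
  assumes "q \<in> polyfun" "q z \<noteq> 0"
  shows "regular_on (ratdom p q) (ratval p q)"
  unfolding regular_on_def
proof
  fix x assume "x \<in> ratdom p q"
  then obtain p' q' where *: "same_ratfun p q p' q'" "q' x \<noteq> 0" unfolding ratdom_def by blast
  show "\<exists>a\<in>polyfun. \<exists>b\<in>polyfun. b x \<noteq> 0 \<and> (\<forall>y. b y \<noteq> 0 \<longrightarrow> y \<in> ratdom p q) \<and>
      (\<forall>y\<in>ratdom p q. ratval p q y * b y = a y)"
  proof (rule bexI[of _ p'], rule bexI[of _ q'], intro conjI)
    show "p' \<in> polyfun" "q' \<in> polyfun" using *(1) unfolding same_ratfun_def by auto
    show "\<forall>y\<in>ratdom p q. ratval p q y * q' y = p' y" using same_ratfun_ratval[OF assms *(1)] by blast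
    show "\<forall>y. q' y \<noteq> 0 \<longrightarrow> y \<in> ratdom p q" using *(1) unfolding ratdom_def by blast
  qed (rule *(2))
qed

section \<open>The extension criterion for rational functions\<close>

theorem theorem2p12:
  fixes p q :: "real^'n \<Rightarrow> real" and k :: nat
  assumes "k \<ge> 1"
    and "p \<in> polyfun" and "q \<in> polyfun" and "\<exists>x. q x \<noteq> 0"
    and "codim_ge2 (ratpol p q)"
  shows "(\<exists>g. regulous k g \<and> (\<forall>x\<in>ratdom p q. g x = ratval p q x)) \<longleftrightarrow>
         (\<forall>is :: 'n list. length is = k \<longrightarrow>
            (\<exists>h. continuous_on UNIV h \<and>
                 (\<forall>x\<in>ratdom p q. h x = partials is (ratval p q) x)))"
proof (intro iffI allI impI)
  fix "is" :: "'n list"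
  assume "\<exists>g. regulous k g \<and> (\<forall>x\<in>ratdom p q. g x = ratval p q x)" and len: "length is = k"
  then obtain g where g: "Ck k g" "\<And>x. x \<in> ratdom p q \<Longrightarrow> g x = ratval p q x"
    unfolding regulous_def by blast
  show "\<exists>h. continuous_on UNIV h \<and> (\<forall>x\<in>ratdom p q. h x = partials is (ratval p q) x)"
  \<comment> \<open>The partial derivative of the extension \<open>g\<close> is itself the required
    continuous function, since the domain is open and \<open>g\<close> agrees with the rational
    function there.\<close>
  proof (intro exI conjI ballI)
    show "continuous_on UNIV (partials is g)" by (rule Ck_continuous_on_partials[OF g(1) len])
    show "partials is g x = partials is (ratval p q) x" if "x \<in> ratdom p q" for x
      by (rule partials_cong_open[OF open_ratdom _ that]) (rule g(2))
  qed
next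
  assume ext: "\<forall>is :: 'n list. length is = k \<longrightarrow>
    (\<exists>h. continuous_on UNIV h \<and> (\<forall>x\<in>ratdom p q. h x = partials is (ratval p q) x))"
  obtain z where z: "q z \<noteq> 0" using assms(4) by blast
  have same: "same_ratfun p q p q" using assms(2,3) unfolding same_ratfun_def by simp
  then have sub: "{x. q x \<noteq> 0} \<subseteq> ratdom p q" unfolding ratdom_def by blast
  have "x islimpt ratdom p q" for x
    using islimpt_subset[OF islimpt_polyfun_nonzero[OF assms(3) z] sub] .
  then have "\<exists>g. Ck k g \<and> (\<forall>x\<in>ratdom p q. g x = ratval p q x)"
    using ext by (intro regular_on_Ck_extend open_ratdom regular_on_ratval[OF assms(3) z]) auto
  then obtain g where g: "Ck k g" "\<And>x. x \<in> ratdom p q \<Longrightarrow> g x = ratval p q x" by blast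
  have "q x \<noteq> 0 \<and> g x = p x / q x" if "x \<in> {x. q x \<noteq> 0}" for x
    using same_ratfun_ratval[OF assms(3) z same, of x] g(2)[of x] sub that by (auto simp: field_simps)
  \<comment> \<open>The Zariski open set is the nonvanishing locus of \<open>q\<close>; it contains
    \<open>z\<close>, and its complement is the zero set of \<open>q\<close> itself.\<close>
  then have "regulous k g"
    unfolding regulous_def using g(1) assms(2,3) z
    by (intro conjI exI[of _ p] exI[of _ q] exI[of _ "{x. q x \<noteq> 0}"] bexI[of _ q]) auto
  then show "\<exists>g. regulous k g \<and> (\<forall>x\<in>ratdom p q. g x = ratval p q x)" using g(2) by blast
qed

end
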